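(* Let $(X,E)$ be an undirected simple graph with finite vertex set $X$, let $Y$ be a finite set and let $F:X\to 2^Y$ be a set-valued mapping. For Calculation Method 2 applied to $F$, with largest occurring index $i^{max}_2$, the following statements are equivalent: (i) $F$ admits a disparate selection. (ii) Calculation Method 2 does not stop at Step 3. (iii) Calculation Method 2 stops at Step 5. (iv) $i^{max}_2=\sharp X$ and a disparate selection $s$ of $F$ is given by $s(x_i)=y_i$ for $i=1,\dots,i^{max}_2$ (where $(x_i,y_i)$ are the points chosen in Step 4).
   Context: Setting. $(X,E)$ is an undirected simple graph with finite vertex set $X$, $Y$ is a finite set, $F:X\to 2^Y$ is a set-valued mapping (nonempty images are not required as a general condition). $\sharp$ denotes cardinality; $\subset$ allows equality. $G(F)=\{(x,y)\in X\times Y\mid y\in F(x)\}$ is the graph of $F$; $F_{|W}$ is the restriction of $F$ to $W\subset X$. A submapping of $F$ is a set-valued mapping $F'$ on the same domain with $G(F')\subset G(F)$. A selection of $F$ is a map $s:X\to Y$ with $s(x)\in F(x)$ for all $x\in X$. Disparate. Points $(x,y),(x',y')\in X\times Y$ are disparate if $(x,y)\ne(x',y')$ and ($y=y'$ implies $\{x,x'\}\notin E$). A set $A\subset X\times Y$ is disparate if any two distinct points of $A$ are disparate. A selection $s$ is disparate if $G(s)=\{(x,s(x))\mid x\in X\}$ is a disparate set. For $A\subset X\times Y$: $hull(A)=\{a\in X\times Y\mid$ there is $a'\in A$ such that $a,a'$ are not disparate$\}$ and $compl(A)=\{a\in X\times Y\mid a,a'$ are disparate for every $a'\in A\}$. Complement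 mapping. For $W\subset X$ and $Z\subset W\times Y$, $F_{W,Z}:X\setminus W\to 2^Y$ is defined by $G(F_{W,Z})=G(F_{|X\setminus W})\cap compl(Z)$. Convention. For a mapping defined on a subset $X'\subset X$, all notions are understood with $X'$ and the subgraph of $(X,E)$ induced by $X'$ in place of $X$ and $(X,E)$. Collections. A collection of $F$ is a family $\mathcal H=(A_V)$ indexed by the nonempty sets $V\subset X$, with $A_V\subset G(F_{|V})$. It is a Hall collection if every $A_V$ is disparate and $\sharp A_V\ge\sharp V$. For $W\subset X$, $\mathcal H_{|W}$ is the family of the $A_V$ with $\emptyset\ne V\subset W$ (a collection of $F_{|W}$), and $\mathcal H_W$ is the family, indexed by the nonempty $V\subset X\setminus W$, of the sets $A_{W\cup V}\cap compl(\bigcup_{A\in\mathcal H_{|W}}A)\cap(V\times Y)$ (a collection of $F_{|X\setminus W}$). For nonempty $W$, $F^{\mathcal H_W}$ is the submapping of $F_{|W}$ with graph $G(F_{|W})\cap compl(\bigcup_{A\in\mathcal H_W}A)$. For nonempty $W$, $\mathcal H$ is $W$-distributed if for every nonempty $V\subset X\setminus W$, $$\sharp\Bigl(A_{W\cup V}\cap\bigl((W\times Y)\cup(hull(\textstyle\bigcup_{A\in\mathcal H_{|W}}A)\cap(V\times Y))\bigr)\Bigr)\le\sharp W .$$ Cascades. For a tuple $(W_1,\dots,W_k)$, $k\ge1$, of subsets of $W_0=X$ put $W_0^c=W_0$ and, for $i=1,\dots,k$, $W_i^c=W_{i-1}\setminus W_i$ if $W_i\subset W_{i-1}$, and $W_i^c=W_{i-1}^c\setminus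 W_i$ otherwise. The tuple is a cascade in $X$ if $W_i\subset W_{i-1}$ or $W_i\subset W_{i-1}^c$ for $i=1,\dots,k$. Put $pre(i)=W_{i-1}$ if $W_i\subset W_{i-1}$ and $pre(i)=W_{i-1}^c$ if $W_i\subset W_{i-1}^c$. Given a collection $\mathcal H$ of $F$ and a cascade, put $\mathcal H(W_1,\dots,W_0)=\mathcal H$, $F(W_1,\dots,W_0)=F$ and inductively for $i=1,\dots,k-1$, writing $\mathcal H'=\mathcal H(W_1,\dots,W_{i-1})$, $F'=F(W_1,\dots,W_{i-1})$ and $\tilde F=F'^{\,\mathcal H'_{W_i}}$: if $W_{i+1}\subset W_i$, then $\mathcal H(W_1,\dots,W_i)=\mathcal H'_{|W_i}$ and $F(W_1,\dots,W_i)=\tilde F$; if $W_{i+1}\subset W_i^c$, then $\mathcal H(W_1,\dots,W_i)=\mathcal H'_{W_i}$ and $F(W_1,\dots,W_i)=F'_{W_i,G(\tilde F)}$. Here $F(W_1,\dots,W_{i-1})$ is a mapping on $pre(i)$ and $\mathcal H(W_1,\dots,W_{i-1})$ is a collection of it. Generalized Hall condition (recursion on $\sharp X\ge 1$). If $\sharp X=1$, $F$ satisfies it if $G(F)\ne\emptyset$. Let $\sharp X>1$ and suppose the condition is defined for mappings on smaller vertex sets. - A nonempty $W\subset X$ is a generalized critical set of $F$ if there is $(x,y)\in(X\setminus W)\times Y$ such that $(F_{\{x\},\{(x,y)\}})_{|W}$ does not satisfy the generalized Hall condition. It is minimal if no proper subset of $W$ is a generalized critical set of $F$. - For a Hall collection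 $\mathcal H$ of $F$, a cascade $(W_1,\dots,W_k)$ in $X$ is a primitive $(F,\mathcal H)$-critical cascade if $W_i$ is a minimal generalized critical set of $F(W_1,\dots,W_{i-1})$ for $i=1,\dots,k$. - A Hall collection $\mathcal H$ of $F$ is distributed if for each primitive $(F,\mathcal H)$-critical cascade $(W_1,\dots,W_k)$ in $X$ the collection $\mathcal H(W_1,\dots,W_{i-1})$ of $F(W_1,\dots,W_{i-1})$ is $W_i$-distributed for $i=1,\dots,k$. - $F$ satisfies the generalized Hall condition if $F$ admits a distributed Hall collection. Disparate kernel. $F^*$ is the submapping of $F$ with $F^*(x)=\{y\in F(x)\mid$ there is a disparate selection $s$ of $F$ with $s(x)=y\}$. Elimination. For nonempty $W\subset X$, $elim_F(W)$ is the set of all $(x,y)\in G(F_{|X\setminus W})$ such that $(F_{\{x\},\{(x,y)\}})_{|W}$ does not satisfy the generalized Hall condition. A nonempty $W\subset X$ is an elimination set of $F$ if $elim_F(W)\ne\emptyset$. Calculation Method 1 (applied to a mapping $P$ on a vertex set $X'$). Step 1: set $P^1=P$ and $j=1$. Step 2: choose an elimination set $W\subset X'$ of $P^j$. Step 3: if $P^j$ does not admit an elimination set, STOP; otherwise continue. Step 4: define $P^{j+1}$ by $G(P^{j+1})=G(P^j)\setminus elim_{P^j}(W)$. Step 5: if $P^{j+1}(x)=\emptyset$ for some $x\in X'$, STOP; otherwise continue. Step 6: increase $j$ to $j+1$ and continue with Step 2. The method always terminates. If $G(P)\ne\emptyset$ and it stops at Step 3, its final mapping is $P^*$; if $G(P)\neq\emptyset$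 and it stops at Step 5, $P$ admits no disparate selection. Calculation Method 2. Step 1: set $F^1=F$ and $i=1$. Step 2: determine the disparate kernel $(F^i)^*$ of $F^i$ with Calculation Method 1. Step 3: if Calculation Method 1 terminates at its Step 5, STOP; otherwise continue. Step 4: choose $(x_i,y_i)\in G((F^i)^* )$. Step 5: if $i=\sharp X$, STOP; otherwise continue. Step 6: set $F^{i+1}=((F^i)^* )_{\{x_i\},\{(x_i,y_i)\}}$ (a mapping on $X\setminus\{x_1,\dots,x_i\}$), increase $i$ to $i+1$ and continue with Step 2. The method terminates after finitely many steps; $i^{max}_2$ denotes the largest value of the index $i$ which occurs. *)

theory Defs
  imports Main
begin

definition simple_graph :: "'x set \<Rightarrow> 'x set set \<Rightarrow> bool" where
  "simple_graph X E \<longleftrightarrow> (\<forall>e\<in>E. e \<subseteq> X \<and> card e = 2)"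

text \<open>
  A set-valued mapping with domain \<open>X\<close> is a function \<open>F :: 'x \<Rightarrow> 'y set\<close> together with the
  separate argument \<open>X\<close>; values outside \<open>X\<close> are ignored, its graph is \<open>Sigma X F\<close>, and
  \<open>F\<close> together with \<open>W \<subseteq> X\<close> is its restriction to \<open>W\<close>. In the same way a family of sets
  indexed by the nonempty subsets of \<open>X\<close> is a function \<open>H\<close> on all sets together with \<open>X\<close>,
  and \<open>H\<close> together with \<open>W\<close> is the restricted family.

  The edge set \<open>E\<close> is never cut down to an induced subgraph: for mappings with domain \<open>X'\<close>,
  only edges between vertices of \<open>X'\<close> are inspected.
\<close>

definition mapping_of :: "('x \<times> 'y) set \<Rightarrow> 'x \<Rightarrow> 'y set" where
  "mapping_of R x = R `` {x}"

definition nonempty_subsets :: "'x set \<Rightarrow> 'x set set" where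
  "nonempty_subsets W = {V. V \<noteq> {} \<and> V \<subseteq> W}"

datatype stop_step = Step3 | Step5

text \<open>
  For a tuple \<open>Ws = [W\<^sub>1, \<dots>, W\<^sub>k]\<close>, \<open>cW X Ws i\<close> is \<open>W\<^sub>i\<close> (with \<open>W\<^sub>0 = X\<close>), and
  \<open>cWc X Ws i\<close> is \<open>W\<^sub>i\<^sup>c\<close>.
\<close>

definition cW :: "'x set \<Rightarrow> 'x set list \<Rightarrow> nat \<Rightarrow> 'x set" where
  "cW X Ws i = (X # Ws) ! i"

fun cWc :: "'x set \<Rightarrow> 'x set list \<Rightarrow> nat \<Rightarrow> 'x set" where
  "cWc X Ws 0 = X"
| "cWc X Ws (Suc i) =
     (if cW X Ws (Suc i) \<subseteq> cW X Ws i then cW X Ws i - cW X Ws (Suc i)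
      else cWc X Ws i - cW X Ws (Suc i))"

definition cascade :: "'x set \<Rightarrow> 'x set list \<Rightarrow> bool" where
  "cascade X Ws \<longleftrightarrow> Ws \<noteq> [] \<and>
     (\<forall>i\<in>{1..length Ws}. cW X Ws i \<subseteq> cW X Ws (i - 1) \<or> cW X Ws i \<subseteq> cWc X Ws (i - 1))"

text \<open>Intended for \<open>i \<ge> 1\<close> only.\<close>

definition pre :: "'x set \<Rightarrow> 'x set list \<Rightarrow> nat \<Rightarrow> 'x set" where
  "pre X Ws i =
     (if cW X Ws i \<subseteq> cW X Ws (i - 1) then cW X Ws (i - 1) else cWc X Ws (i - 1))"

context
  fixes E :: "'x set set" and Y :: "'y set"
begin

definition disparate :: "'x \<times> 'y \<Rightarrow> 'x \<times> 'y \<Rightarrow> bool" where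
  "disparate p q \<longleftrightarrow> p \<noteq> q \<and> (snd p = snd q \<longrightarrow> {fst p, fst q} \<notin> E)"

definition disparate_set :: "('x \<times> 'y) set \<Rightarrow> bool" where
  "disparate_set A \<longleftrightarrow> pairwise disparate A"

definition disparate_selection :: "'x set \<Rightarrow> ('x \<Rightarrow> 'y set) \<Rightarrow> ('x \<Rightarrow> 'y) \<Rightarrow> bool" where
  "disparate_selection X F s \<longleftrightarrow>
     (\<forall>x\<in>X. s x \<in> F x) \<and> disparate_set ((\<lambda>x. (x, s x)) ` X)"

definition dhull :: "'x set \<Rightarrow> ('x \<times> 'y) set \<Rightarrow> ('x \<times> 'y) set" where
  "dhull X A = {a \<in> X \<times> Y. \<exists>a'\<in>A. \<not> disparate a a'}"

definition dcompl :: "'x set \<Rightarrow> ('x \<times> 'y) set \<Rightarrow> ('x \<times> 'y) set" where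
  "dcompl X A = {a \<in> X \<times> Y. \<forall>a'\<in>A. disparate a a'}"

text \<open>\<open>F\<^bsub>W,Z\<^esub>\<close>, a mapping with domain \<open>X - W\<close>.\<close>

definition compl_map ::
    "'x set \<Rightarrow> ('x \<Rightarrow> 'y set) \<Rightarrow> 'x set \<Rightarrow> ('x \<times> 'y) set \<Rightarrow> 'x \<Rightarrow> 'y set" where
  "compl_map X F W Z = mapping_of (Sigma (X - W) F \<inter> dcompl X Z)"

definition hall_collection ::
    "'x set \<Rightarrow> ('x \<Rightarrow> 'y set) \<Rightarrow> ('x set \<Rightarrow> ('x \<times> 'y) set) \<Rightarrow> bool" where
  "hall_collection X F H \<longleftrightarrow>
     (\<forall>V\<in>nonempty_subsets X. H V \<subseteq> Sigma V F \<and> disparate_set (H V) \<and> card (H V) \<ge> card V)"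

text \<open>\<open>H\<^sub>W\<close>, indexed by the nonempty subsets of \<open>X - W\<close>.\<close>

definition compl_coll ::
    "'x set \<Rightarrow> ('x set \<Rightarrow> ('x \<times> 'y) set) \<Rightarrow> 'x set \<Rightarrow> 'x set \<Rightarrow> ('x \<times> 'y) set" where
  "compl_coll X H W V =
     H (W \<union> V) \<inter> dcompl X (\<Union>U\<in>nonempty_subsets W. H U) \<inter> (V \<times> Y)"

text \<open>The submapping of \<open>F\<close> restricted to \<open>W\<close> that is written \<open>F\<close> with superscript \<open>H\<^sub>W\<close>.\<close>

definition coll_map ::
    "'x set \<Rightarrow> ('x \<Rightarrow> 'y set) \<Rightarrow> ('x set \<Rightarrow> ('x \<times> 'y) set) \<Rightarrow> 'x set \<Rightarrow> 'x \<Rightarrow> 'y set" where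
  "coll_map X F H W =
     mapping_of (Sigma W F \<inter> dcompl X (\<Union>V\<in>nonempty_subsets (X - W). compl_coll X H W V))"

definition set_distributed :: "'x set \<Rightarrow> ('x set \<Rightarrow> ('x \<times> 'y) set) \<Rightarrow> 'x set \<Rightarrow> bool" where
  "set_distributed X H W \<longleftrightarrow>
     (\<forall>V\<in>nonempty_subsets (X - W).
        card (H (W \<union> V) \<inter>
              (W \<times> Y \<union> dhull X (\<Union>U\<in>nonempty_subsets W. H U) \<inter> V \<times> Y)) \<le> card W)"

text \<open>
  \<open>along X F H Ws i\<close> is the pair of \<open>H(W\<^sub>1, \<dots>, W\<^sub>i)\<close> and \<open>F(W\<^sub>1, \<dots>, W\<^sub>i)\<close>, for
  \<open>i < length Ws\<close>; its domain is \<open>pre X Ws (i + 1)\<close>. In the first branch the collection is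
  unchanged as a function because restriction only changes the index set.
\<close>

fun along ::
    "'x set \<Rightarrow> ('x \<Rightarrow> 'y set) \<Rightarrow> ('x set \<Rightarrow> ('x \<times> 'y) set) \<Rightarrow> 'x set list \<Rightarrow> nat \<Rightarrow>
     ('x set \<Rightarrow> ('x \<times> 'y) set) \<times> ('x \<Rightarrow> 'y set)" where
  "along X F H Ws 0 = (H, F)"
| "along X F H Ws (Suc i) =
     (let (H', F') = along X F H Ws i;
          D = pre X Ws (Suc i);
          W = cW X Ws (Suc i);
          F'' = coll_map D F' H' W
      in if cW X Ws (Suc (Suc i)) \<subseteq> W then (H', F'')
         else (compl_coll D H' W, compl_map D F' W (Sigma W F'')))"

text \<open>
  The generalized Hall condition is defined by recursion on the number of vertices. In the
  next definitions \<open>Q\<close> stands for the condition on smaller vertex sets.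
\<close>

definition gcritical ::
    "('x set \<Rightarrow> ('x \<Rightarrow> 'y set) \<Rightarrow> bool) \<Rightarrow> 'x set \<Rightarrow> ('x \<Rightarrow> 'y set) \<Rightarrow> 'x set \<Rightarrow> bool" where
  "gcritical Q X F W \<longleftrightarrow> W \<noteq> {} \<and> W \<subseteq> X \<and>
     (\<exists>x\<in>X - W. \<exists>y\<in>Y. \<not> Q W (compl_map X F {x} {(x, y)}))"

definition min_gcritical ::
    "('x set \<Rightarrow> ('x \<Rightarrow> 'y set) \<Rightarrow> bool) \<Rightarrow> 'x set \<Rightarrow> ('x \<Rightarrow> 'y set) \<Rightarrow> 'x set \<Rightarrow> bool" where
  "min_gcritical Q X F W \<longleftrightarrow> gcritical Q X F W \<and> (\<forall>W'. W' \<subset> W \<longrightarrow> \<not> gcritical Q X F W')"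

definition primitive_cascade ::
    "('x set \<Rightarrow> ('x \<Rightarrow> 'y set) \<Rightarrow> bool) \<Rightarrow> 'x set \<Rightarrow> ('x \<Rightarrow> 'y set) \<Rightarrow>
     ('x set \<Rightarrow> ('x \<times> 'y) set) \<Rightarrow> 'x set list \<Rightarrow> bool" where
  "primitive_cascade Q X F H Ws \<longleftrightarrow> cascade X Ws \<and>
     (\<forall>i\<in>{1..length Ws}.
        min_gcritical Q (pre X Ws i) (snd (along X F H Ws (i - 1))) (cW X Ws i))"

definition distributed ::
    "('x set \<Rightarrow> ('x \<Rightarrow> 'y set) \<Rightarrow> bool) \<Rightarrow> 'x set \<Rightarrow> ('x \<Rightarrow> 'y set) \<Rightarrow>
     ('x set \<Rightarrow> ('x \<times> 'y) set) \<Rightarrow> bool" where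
  "distributed Q X F H \<longleftrightarrow>
     (\<forall>Ws. primitive_cascade Q X F H Ws \<longrightarrow>
        (\<forall>i\<in>{1..length Ws}.
           set_distributed (pre X Ws i) (fst (along X F H Ws (i - 1))) (cW X Ws i)))"

definition ghall_step ::
    "('x set \<Rightarrow> ('x \<Rightarrow> 'y set) \<Rightarrow> bool) \<Rightarrow> 'x set \<Rightarrow> ('x \<Rightarrow> 'y set) \<Rightarrow> bool" where
  "ghall_step Q X F \<longleftrightarrow>
     (card X = 1 \<and> Sigma X F \<noteq> {}) \<or>
     (card X > 1 \<and> (\<exists>H. hall_collection X F H \<and> distributed Q X F H))"

text \<open>
  The guard \<open>card W < card X\<close> only serves the termination proof; \<open>ghall_iff\<close> below removes it.
  The condition is not meant for the empty vertex set, where it is false.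
\<close>

function ghall :: "'x set \<Rightarrow> ('x \<Rightarrow> 'y set) \<Rightarrow> bool" where
  "ghall X F = ghall_step (\<lambda>W P. if card W < card X then ghall W P else False) X F"
  by pat_completeness auto
termination
  by (relation "measure (\<lambda>(X, F). card X)") auto

declare ghall.simps [simp del]

lemma cascade_subset:
  assumes "cascade X Ws" and "i \<le> length Ws"
  shows "cW X Ws i \<subseteq> X \<and> cWc X Ws i \<subseteq> X"
  using assms(2)
proof (induction i)
  case 0
  show ?case by (simp add: cW_def)
next
  case (Suc i)
  have "cW X Ws (Suc i) \<subseteq> cW X Ws i \<or> cW X Ws (Suc i) \<subseteq> cWc X Ws i"
    using assms(1) Suc.prems unfolding cascade_def by (auto dest!: bspec[of _ _ "Suc i"])
  with Suc show ?case by auto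
qed

lemma pre_subset:
  assumes "cascade X Ws" and "i \<in> {1..length Ws}"
  shows "pre X Ws i \<subseteq> X"
proof -
  have "i - 1 \<le> length Ws" using assms(2) by auto
  then show ?thesis using cascade_subset[OF assms(1), of "i - 1"] by (simp add: pre_def)
qed

lemma gcritical_cong:
  assumes "finite X" and "D \<subseteq> X"
    and "\<And>W P. card W < card X \<Longrightarrow> Q W P = Q' W P"
  shows "gcritical Q D F W = gcritical Q' D F W"
proof -
  have "Q W P = Q' W P" if "W \<subseteq> D" "x \<in> D - W" for x P
  proof -
    have "W \<subset> X" using that assms(2) by blast
    then show ?thesis using assms(1,3) psubset_card_mono by blast
  qed
  then show ?thesis
    unfolding gcritical_def by metis
qed

lemma ghall_iff:
  assumes "finite X"
  shows "ghall X F \<longleftrightarrow> ghall_step ghall X F"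
proof -
  define Q where "Q = (\<lambda>W P. if card W < card X then ghall W P else False)"
  have "gcritical Q D F' W = gcritical ghall D F' W" if "D \<subseteq> X" for D F' W
    by (rule gcritical_cong[OF assms that]) (simp add: Q_def)
  then have "min_gcritical Q D F' W = min_gcritical ghall D F' W" if "D \<subseteq> X" for D F' W
    using that by (simp add: min_gcritical_def)
  then have "primitive_cascade Q X F H Ws = primitive_cascade ghall X F H Ws" for H Ws
    unfolding primitive_cascade_def by (intro conj_cong ball_cong refl) (simp add: pre_subset)
  then show ?thesis
    by (subst ghall.simps) (simp add: ghall_step_def distributed_def flip: Q_def)
qed

definition elim :: "'x set \<Rightarrow> ('x \<Rightarrow> 'y set) \<Rightarrow> 'x set \<Rightarrow> ('x \<times> 'y) set" where
  "elim X F W = {(x, y) \<in> Sigma (X - W) F. \<not> ghall W (compl_map X F {x} {(x, y)})}"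

definition elimination_set :: "'x set \<Rightarrow> ('x \<Rightarrow> 'y set) \<Rightarrow> 'x set \<Rightarrow> bool" where
  "elimination_set X F W \<longleftrightarrow> W \<noteq> {} \<and> W \<subseteq> X \<and> elim X F W \<noteq> {}"

definition elim_map :: "'x set \<Rightarrow> ('x \<Rightarrow> 'y set) \<Rightarrow> 'x set \<Rightarrow> 'x \<Rightarrow> 'y set" where
  "elim_map X P W = mapping_of (Sigma X P - elim X P W)"

text \<open>
  \<open>method1 X P K st\<close>: Calculation Method 1 can, starting at its Step 2 with current mapping
  \<open>P\<close> on \<open>X\<close>, come to a stop at step \<open>st\<close> with final mapping \<open>K\<close>. The choice of elimination
  sets is nondeterministic. Every round removes a point of the finite graph of \<open>P\<close>, so
  inductive (hence terminating) runs are all runs.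
\<close>

inductive method1 ::
    "'x set \<Rightarrow> ('x \<Rightarrow> 'y set) \<Rightarrow> ('x \<Rightarrow> 'y set) \<Rightarrow> stop_step \<Rightarrow> bool" for X where
  stop3: "(\<And>W. \<not> elimination_set X P W) \<Longrightarrow> method1 X P P Step3"
| stop5: "elimination_set X P W \<Longrightarrow> \<exists>x\<in>X. elim_map X P W x = {} \<Longrightarrow>
          method1 X P (elim_map X P W) Step5"
| continue: "elimination_set X P W \<Longrightarrow> \<forall>x\<in>X. elim_map X P W x \<noteq> {} \<Longrightarrow>
          method1 X (elim_map X P W) K st \<Longrightarrow> method1 X P K st"

text \<open>
  \<open>method2 n x y i D P m st\<close>: Calculation Method 2 for a mapping on \<open>n\<close> vertices can, arriving
  at its Step 2 with index \<open>i\<close> and \<open>F\<^sup>i = P\<close> on \<open>D\<close>, come to a stop at step \<open>st\<close>, where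
  \<open>(x j, y j)\<close> is the point chosen in Step 4 at index \<open>j\<close> and \<open>m\<close> is the index at the stop.
  As the index never decreases, \<open>m\<close> is the largest index that occurs. If the run stops at
  Step 3, no point is chosen at index \<open>m\<close>, and \<open>x m\<close> and \<open>y m\<close> are arbitrary.

  The disparate kernel used in Steps 4 and 6 is the one determined in Step 2, that is, the
  final mapping \<open>K\<close> of Calculation Method 1. If the initial mapping has empty graph, then
  Step 4 cannot be carried out and there is no run.
\<close>

inductive method2 ::
    "nat \<Rightarrow> (nat \<Rightarrow> 'x) \<Rightarrow> (nat \<Rightarrow> 'y) \<Rightarrow> nat \<Rightarrow> 'x set \<Rightarrow> ('x \<Rightarrow> 'y set) \<Rightarrow> nat \<Rightarrow>
     stop_step \<Rightarrow> bool" for n x y where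
  stop3: "method1 D P K Step5 \<Longrightarrow> method2 n x y i D P i Step3"
| stop5: "method1 D P K Step3 \<Longrightarrow> (x i, y i) \<in> Sigma D K \<Longrightarrow> i = n \<Longrightarrow>
          method2 n x y i D P i Step5"
| continue: "method1 D P K Step3 \<Longrightarrow> (x i, y i) \<in> Sigma D K \<Longrightarrow> i \<noteq> n \<Longrightarrow>
          method2 n x y (Suc i) (D - {x i}) (compl_map D K {x i} {(x i, y i)}) m st \<Longrightarrow>
          method2 n x y i D P m st"

end

end

theory Submission
  imports Defs
begin

text \<open>
  The heart of the matter is that the generalized Hall condition characterizes the existence of
  a disparate selection (on a nonempty vertex set).

  If \<open>s\<close> is a disparate selection, then the sets \<open>A\<^sub>V = {(v, s v) | v \<in> V}\<close> form a Hall
  collection. Passing to \<open>H\<^sub>W\<close> removes nothing from such a collection, because the graph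
  of \<open>s\<close> is disparate; so at every stage of every cascade the collection still
  consists of these sets, and all the required cardinality bounds hold
  (\<open>ghall_if_disparate_selection\<close>).

  Conversely, let \<open>H\<close> be a distributed Hall collection; the proof is by induction on the
  number of vertices. If there is no critical set, any point \<open>(a, b)\<close> of the graph of \<open>F\<close>
  may be fixed: the rest of the mapping, restricted to the complement of \<open>(a, b)\<close>, satisfies
  the condition and hence has a disparate selection. Otherwise let \<open>W\<close> be a minimal
  critical set. Being \<open>W\<close>-distributed guarantees that \<open>H\<^sub>W\<close> still has enough points to be a
  Hall collection (\<open>hall_collection_complement\<close>). Putting \<open>W\<close> in front of a primitive
  cascade in \<open>W\<close> or in \<open>X - W\<close> gives a primitive cascade in \<open>X\<close>, so both \<open>H\<close> on \<open>W\<close> and \<open>H\<^sub>W\<close>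
  on \<open>X - W\<close> are again distributed (\<open>distributed_tail\<close>). The induction hypothesis
  gives disparate selections on both parts. They fit together, because the graph of the mapping
  on \<open>X - W\<close> lies in the complement of the graph of the mapping on \<open>W\<close>
  (\<open>disparate_selection_if_ghall\<close>).

  For the calculation methods it follows that no elimination step destroys a disparate
  selection, and that a mapping without elimination set has, through each point of its graph, a
  disparate selection. So Method 2 can stop at its Step 3 only at the first index, and only
  if there is no disparate selection. If it stops at Step 5, the chosen points are pairwise
  disparate by construction.
\<close>

section \<open>Disparate points and selections\<close>

lemma disparate_sym: "disparate E p q \<longleftrightarrow> disparate E q p"
  unfolding disparate_def by (metis insert_commute)

lemma disparate_selection_iff:
  "disparate_selection E X F s \<longleftrightarrow>
     (\<forall>u\<in>X. s u \<in> F u) \<and> (\<forall>u\<in>X. \<forall>v\<in>X. u \<noteq> v \<longrightarrow> disparate E (u, s u) (v, s v))"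
  unfolding disparate_selection_def disparate_set_def pairwise_def by auto

lemma mem_compl_map_iff:
  "b \<in> compl_map E Y X F W Z a \<longleftrightarrow>
     a \<in> X - W \<and> b \<in> F a \<and> b \<in> Y \<and> (\<forall>z\<in>Z. disparate E (a, b) z)"
  by (auto simp: compl_map_def mapping_of_def dcompl_def)

lemma mem_coll_map_iff:
  assumes "W \<subseteq> X"
  shows "b \<in> coll_map E Y X F H W a \<longleftrightarrow>
     a \<in> W \<and> b \<in> F a \<and> b \<in> Y \<and>
     (\<forall>V\<in>nonempty_subsets (X - W). \<forall>z\<in>compl_coll E Y X H W V. disparate E (a, b) z)"
  using assms by (auto simp: coll_map_def mapping_of_def dcompl_def)

lemma disparate_selection_union:
  assumes "disparate_selection E A P s" and "disparate_selection E B R t"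
    and "\<And>u. u \<in> A \<Longrightarrow> P u \<subseteq> F u" and "\<And>u. u \<in> B \<Longrightarrow> R u \<subseteq> F u"
    and "A \<inter> B = {}"
    and "\<And>u v. u \<in> A \<Longrightarrow> v \<in> B \<Longrightarrow> disparate E (u, s u) (v, t v)"
  shows "disparate_selection E (A \<union> B) F (\<lambda>u. if u \<in> A then s u else t u)"
proof -
  have "disparate E (v, t v) (u, s u)" if "u \<in> A" "v \<in> B" for u v
    using assms(6)[OF that] disparate_sym by blast
  moreover have "v \<notin> A" if "v \<in> B" for v
    using that assms(5) by blast
  ultimately show ?thesis
    using assms unfolding disparate_selection_iff by (simp add: subset_iff ball_Un)
qed

text \<open>A disparate selection on the complement of a point extends by that point.\<close>

lemma disparate_selection_insert:
  assumes "a \<in> X" and "b \<in> F a"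
    and "disparate_selection E (X - {a}) (compl_map E Y X F {a} {(a, b)}) s"
  shows "disparate_selection E X F (s(a := b))"
proof -
  have "disparate E (v, s v) (a, b)" if "v \<in> X" "v \<noteq> a" for v
    using assms(3) that unfolding disparate_selection_iff mem_compl_map_iff by blast
  moreover from this have "disparate E (a, b) (v, s v)" if "v \<in> X" "v \<noteq> a" for v
    using that disparate_sym by blast
  ultimately show ?thesis
    using assms unfolding disparate_selection_iff mem_compl_map_iff by auto
qed

section \<open>Necessity of the generalized Hall condition\<close>

text \<open>The graph of a map \<open>s\<close> over \<open>V\<close>.\<close>

definition map_graph :: "('x \<Rightarrow> 'y) \<Rightarrow> 'x set \<Rightarrow> ('x \<times> 'y) set" where
  "map_graph s V = (\<lambda>v. (v, s v)) ` V"

lemma mem_map_graph_iff [simp]: "p \<in> map_graph s V \<longleftrightarrow> fst p \<in> V \<and> snd p = s (fst p)"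
  by (cases p) (auto simp: map_graph_def)

lemma card_map_graph [simp]: "card (map_graph s V) = card V"
  unfolding map_graph_def by (rule card_image) (simp add: inj_on_def)

lemma compl_coll_map_graph:
  assumes "disparate_selection E X F s" and "\<And>u. u \<in> X \<Longrightarrow> s u \<in> Y"
    and "D \<subseteq> X" and "W \<subseteq> D" and "V \<subseteq> D - W"
    and "\<And>U. U \<subseteq> D \<Longrightarrow> H U = map_graph s U"
  shows "compl_coll E Y D H W V = map_graph s V"
proof -
  have HV: "H (W \<union> V) = map_graph s (W \<union> V)"
    using assms(4,5) by (intro assms(6)) auto
  have HW: "(\<Union>U\<in>nonempty_subsets W. H U) \<subseteq> map_graph s W"
    using assms(4) by (auto simp: nonempty_subsets_def assms(6))
  have "disparate E (v, s v) (w, s w)" if "v \<in> V" "w \<in> W" for v w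
  proof -
    have "v \<in> X" "w \<in> X" "v \<noteq> w"
      using that assms(3-5) by auto
    then show ?thesis
      using assms(1) unfolding disparate_selection_iff by blast
  qed
  then have "disparate E p q" if "p \<in> map_graph s V" "q \<in> map_graph s W" for p q
    using that by (cases p; cases q) auto
  then have "map_graph s V \<subseteq> dcompl E Y D (\<Union>U\<in>nonempty_subsets W. H U)"
    using HW assms(2,3,5) unfolding dcompl_def by fastforce
  then show ?thesis
    using HV assms(2,3,5) unfolding compl_coll_def by fastforce
qed

lemma set_distributed_map_graph:
  assumes "disparate_selection E X F s" and "finite W"
    and "D \<subseteq> X" and "W \<subseteq> D"
    and "\<And>U. U \<subseteq> D \<Longrightarrow> H U = map_graph s U"
  shows "set_distributed E Y D H W"
  unfolding set_distributed_def
proof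
  fix V assume V: "V \<in> nonempty_subsets (D - W)"
  have HV: "H (W \<union> V) = map_graph s (W \<union> V)"
    using assms(4) V by (intro assms(5)) (auto simp: nonempty_subsets_def)
  have "disparate E (v, s v) (w, s w)" if "v \<in> V" "w \<in> W" for v w
  proof -
    have "v \<in> X" "w \<in> X" "v \<noteq> w"
      using that assms(3,4) V by (auto simp: nonempty_subsets_def)
    then show ?thesis
      using assms(1) unfolding disparate_selection_iff by blast
  qed
  moreover have "(\<Union>U\<in>nonempty_subsets W. H U) \<subseteq> map_graph s W"
    using assms(4) by (auto simp: nonempty_subsets_def assms(5))
  ultimately have "map_graph s V \<inter> dhull E Y D (\<Union>U\<in>nonempty_subsets W. H U) = {}"
    unfolding dhull_def by fastforce
  then have "H (W \<union> V) \<inter> (W \<times> Y \<union> dhull E Y D (\<Union>U\<in>nonempty_subsets W. H U) \<inter> V \<times> Y)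
      \<subseteq> map_graph s W"
    unfolding HV by (auto simp: disjoint_iff mem_Times_iff)
  moreover have "finite (map_graph s W)"
    using assms(2) by (simp add: map_graph_def)
  ultimately show "card (H (W \<union> V) \<inter>
      (W \<times> Y \<union> dhull E Y D (\<Union>U\<in>nonempty_subsets W. H U) \<inter> V \<times> Y)) \<le> card W"
    by (metis card_map_graph card_mono)
qed

lemma cWc_Suc_eq_pre: "cWc X Ws (Suc i) = pre X Ws (Suc i) - cW X Ws (Suc i)"
  by (simp add: pre_def)

lemma pre_Suc_Suc_cases:
  "pre X Ws (Suc (Suc i)) =
     (if cW X Ws (Suc (Suc i)) \<subseteq> cW X Ws (Suc i) then cW X Ws (Suc i)
      else pre X Ws (Suc i) - cW X Ws (Suc i))"
  unfolding pre_def[of X Ws "Suc (Suc i)"] by (simp only: cWc_Suc_eq_pre diff_Suc_1)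

lemma cascade_cW_subset_pre:
  assumes "cascade X Ws" and "i < length Ws"
  shows "cW X Ws (Suc i) \<subseteq> pre X Ws (Suc i)"
  using assms unfolding cascade_def pre_def by (auto dest!: bspec[of _ _ "Suc i"])

text \<open>
  The graphs of a disparate selection form a collection that survives every stage of a cascade.
\<close>

lemma along_map_graph:
  assumes s: "disparate_selection E X F s" "\<And>u. u \<in> X \<Longrightarrow> s u \<in> Y"
    and Ws: "cascade X Ws" and "i < length Ws" and "V \<subseteq> pre X Ws (Suc i)"
  shows "fst (along E Y X F (map_graph s) Ws i) V = map_graph s V"
  using assms(4,5)
proof (induction i arbitrary: V)
  case 0
  show ?case by simp
next
  case (Suc i)
  define H' where "H' = fst (along E Y X F (map_graph s) Ws i)"
  define D where "D = pre X Ws (Suc i)"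
  define W where "W = cW X Ws (Suc i)"
  have IH: "H' U = map_graph s U" if "U \<subseteq> D" for U
    using Suc that by (simp add: H'_def D_def)
  have D: "D \<subseteq> X" unfolding D_def
    using Suc.prems by (intro pre_subset[OF Ws]) simp
  have W: "W \<subseteq> D" unfolding W_def D_def
    using Suc.prems by (intro cascade_cW_subset_pre[OF Ws]) simp
  show ?case
  proof (cases "cW X Ws (Suc (Suc i)) \<subseteq> W")
    case True
    then have "V \<subseteq> W" using Suc.prems(2) by (simp only: pre_Suc_Suc_cases W_def if_True)
    moreover have "fst (along E Y X F (map_graph s) Ws (Suc i)) = H'"
      using True by (simp add: H'_def W_def Let_def split_beta)
    ultimately show ?thesis using IH W by simp
  next
    case False
    then have "V \<subseteq> D - W"
      using Suc.prems(2) by (simp only: pre_Suc_Suc_cases W_def D_def if_False)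
    moreover have "fst (along E Y X F (map_graph s) Ws (Suc i)) = compl_coll E Y D H' W"
      using False by (simp add: H'_def W_def D_def Let_def split_beta)
    ultimately show ?thesis using compl_coll_map_graph[OF s D W _ IH] by simp
  qed
qed

lemma ghall_if_disparate_selection:
  assumes X: "finite X" "X \<noteq> {}" and F: "\<And>u. u \<in> X \<Longrightarrow> F u \<subseteq> Y"
    and s: "disparate_selection E X F s"
  shows "ghall E Y X F"
proof -
  have sY: "s u \<in> Y" if "u \<in> X" for u
    using s F that unfolding disparate_selection_iff by blast
  have "hall_collection E X F (map_graph s)"
    unfolding hall_collection_def
  proof
    fix V assume "V \<in> nonempty_subsets X"
    then have "V \<subseteq> X" by (simp add: nonempty_subsets_def)
    then have disp: "disparate E (u, s u) (v, s v)" if "u \<in> V" "v \<in> V" "u \<noteq> v" for u v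
      using s that unfolding disparate_selection_iff by blast
    have "map_graph s V \<subseteq> Sigma V F"
      using s \<open>V \<subseteq> X\<close> unfolding disparate_selection_iff by auto
    moreover from disp have "disparate_set E (map_graph s V)"
      by (auto simp: disparate_set_def pairwise_def map_graph_def)
    ultimately show "map_graph s V \<subseteq> Sigma V F \<and> disparate_set E (map_graph s V) \<and>
        card V \<le> card (map_graph s V)"
      by simp
  qed
  moreover have "distributed E Y (ghall E Y) X F (map_graph s)"
    unfolding distributed_def primitive_cascade_def
  proof (intro allI impI ballI, elim conjE)
    fix Ws i assume Ws: "cascade X Ws" and i: "i \<in> {1..length Ws}"
    define j where "j = i - 1"
    have ij: "i = Suc j" "j < length Ws" using i by (auto simp: j_def)
    have D: "pre X Ws i \<subseteq> X" using pre_subset[OF Ws i] .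
    have W: "cW X Ws i \<subseteq> pre X Ws i" using cascade_cW_subset_pre[OF Ws ij(2)] ij(1) by simp
    show "set_distributed E Y (pre X Ws i)
        (fst (along E Y X F (map_graph s) Ws (i - 1))) (cW X Ws i)"
      using along_map_graph[OF s sY Ws ij(2)] D W finite_subset[OF _ X(1)] ij(1)
      by (intro set_distributed_map_graph[OF s]) auto
  qed
  moreover have "Sigma X F \<noteq> {}"
    using s X(2) unfolding disparate_selection_iff by blast
  moreover have "card X \<noteq> 0"
    using X by simp
  ultimately show ?thesis
    unfolding ghall_iff[OF X(1)] ghall_step_def by (metis less_one linorder_neqE_nat)
qed

section \<open>Splitting a cascade after its first set\<close>

text \<open>
  In the following lemmas \<open>D\<close> is the domain, either \<open>W\<close> or \<open>X - W\<close>, in which a cascade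
  starting with \<open>W\<close> continues. Seen from \<open>D\<close>, the complements \<open>W\<^sub>i\<^sup>c\<close> agree with
  the old ones only after the first set in \<open>D\<close>. This is enough: the old complement of \<open>W\<close>
  is used only if that first set is not contained in \<open>W\<close>, and then \<open>D = X - W\<close>.
\<close>

lemma cW_Cons: "cW X (W # Ws) (Suc (Suc i)) = cW D Ws (Suc i)"
  by (simp add: cW_def)

lemma cWc_Cons:
  assumes "W \<subseteq> X" and "Ws ! 0 \<subseteq> D" and "Ws ! 0 \<noteq> {}" and "D = W \<or> D = X - W"
  shows "cWc X (W # Ws) (Suc (Suc i)) = cWc D Ws (Suc i)"
proof (induction i)
  case 0
  show ?case using assms by (auto simp: cW_def)
next
  case (Suc i)
  then show ?case
    by (subst (1 2) cWc.simps) (simp only: cW_Cons[where D = D])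
qed

lemma pre_Cons:
  assumes "W \<subseteq> X" and "Ws ! 0 \<subseteq> D" and "Ws ! 0 \<noteq> {}" and "D = W \<or> D = X - W"
  shows "pre X (W # Ws) (Suc (Suc i)) = pre D Ws (Suc i)"
proof (cases i)
  case 0
  then show ?thesis using assms by (auto simp: pre_def cW_def)
next
  case (Suc j)
  show ?thesis
    unfolding Suc pre_def diff_Suc_1 cWc_Cons[OF assms] cW_Cons[where D = D] ..
qed

lemma along_Cons:
  assumes "W \<subseteq> X" and "Ws ! 0 \<subseteq> D" and "Ws ! 0 \<noteq> {}"
    and D: "D = W \<and> H' = H \<and> F' = coll_map E Y X F H W \<or>
      D = X - W \<and> H' = compl_coll E Y X H W \<and>
      F' = compl_map E Y X F W (Sigma W (coll_map E Y X F H W))"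
  shows "along E Y X F H (W # Ws) (Suc i) = along E Y D F' H' Ws i"
proof (induction i)
  case 0
  have "pre X (W # Ws) (Suc 0) = X" using assms(1) by (simp add: pre_def cW_def)
  moreover have "Ws ! 0 \<subseteq> W \<longleftrightarrow> D = W"
    using assms by auto
  moreover have "D = X - W \<longleftrightarrow> D \<noteq> W" using assms by auto
  ultimately show ?case using D by (auto simp: cW_def Let_def)
next
  case (Suc i)
  have "D = W \<or> D = X - W" using D by auto
  note p = pre_Cons[OF assms(1-3) this]
  show ?case
    by (subst along.simps(2), subst (2) along.simps(2))
      (simp only: Suc p cW_Cons[where D = D])
qed

lemma primitive_cascade_Cons:
  assumes W: "min_gcritical E Y Q X F W"
    and D: "D = W \<and> H' = H \<and> F' = coll_map E Y X F H W \<or>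
      D = X - W \<and> H' = compl_coll E Y X H W \<and>
      F' = compl_map E Y X F W (Sigma W (coll_map E Y X F H W))"
    and Ws: "primitive_cascade E Y Q D F' H' Ws"
  shows "primitive_cascade E Y Q X F H (W # Ws)"
    and "W \<subseteq> X" and "Ws ! 0 \<subseteq> D" and "Ws ! 0 \<noteq> {}"
proof -
  show WX: "W \<subseteq> X" using W by (simp add: min_gcritical_def gcritical_def)
  have "Ws \<noteq> []" and crit: "\<And>i. i < length Ws \<Longrightarrow>
      min_gcritical E Y Q (pre D Ws (Suc i)) (snd (along E Y D F' H' Ws i)) (cW D Ws (Suc i))"
    and casc: "\<And>i. i < length Ws \<Longrightarrow>
      cW D Ws (Suc i) \<subseteq> cW D Ws i \<or> cW D Ws (Suc i) \<subseteq> cWc D Ws i"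
    using Ws unfolding primitive_cascade_def cascade_def
    by (auto dest!: bspec[of _ _ "Suc _"])
  from \<open>Ws \<noteq> []\<close> crit[of 0] casc[of 0] show W0: "Ws ! 0 \<subseteq> D" and W0': "Ws ! 0 \<noteq> {}"
    by (auto simp: min_gcritical_def gcritical_def cW_def)
  have D': "D = W \<or> D = X - W" using D by auto
  have crit': "min_gcritical E Y Q (pre X (W # Ws) (Suc i))
      (snd (along E Y X F H (W # Ws) i)) (cW X (W # Ws) (Suc i))" if "i \<le> length Ws" for i
  proof (cases i)
    case 0
    then show ?thesis using W WX by (simp add: pre_def cW_def)
  next
    case (Suc j)
    then show ?thesis
      using crit[of j] that
      unfolding Suc along_Cons[OF WX W0 W0' D] pre_Cons[OF WX W0 W0' D'] cW_Cons[where D = D]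
      by simp
  qed
  have casc': "cW X (W # Ws) (Suc i) \<subseteq> cW X (W # Ws) i \<or>
      cW X (W # Ws) (Suc i) \<subseteq> cWc X (W # Ws) i" if "i \<le> length Ws" for i
  proof -
    consider "i = 0" | "i = 1" | j where "i = Suc (Suc j)"
      by (metis One_nat_def nat.exhaust)
    then show ?thesis
    proof cases
      case 1
      then show ?thesis using WX by (simp add: cW_def)
    next
      case 2
      then show ?thesis using WX W0 D' by (auto simp: cW_def)
    next
      case 3
      then show ?thesis
        using casc[of "Suc j"] that
        unfolding 3 cWc_Cons[OF WX W0 W0' D'] cW_Cons[where D = D] by simp
    qed
  qed
  show "primitive_cascade E Y Q X F H (W # Ws)"
    unfolding primitive_cascade_def cascade_def
  proof (intro conjI ballI)
    show "W # Ws \<noteq> []" by simp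
  next
    fix i assume "i \<in> {1..length (W # Ws)}"
    then have "i - 1 \<le> length Ws" and "Suc (i - 1) = i" by auto
    then show "cW X (W # Ws) i \<subseteq> cW X (W # Ws) (i - 1) \<or>
        cW X (W # Ws) i \<subseteq> cWc X (W # Ws) (i - 1)"
      using casc'[of "i - 1"] by simp
  next
    fix i assume "i \<in> {1..length (W # Ws)}"
    then have "i - 1 \<le> length Ws" and "Suc (i - 1) = i" by auto
    then show "min_gcritical E Y Q (pre X (W # Ws) i)
        (snd (along E Y X F H (W # Ws) (i - 1))) (cW X (W # Ws) i)"
      using crit'[of "i - 1"] by simp
  qed
qed

lemma distributed_tail:
  assumes W: "min_gcritical E Y Q X F W"
    and D: "D = W \<and> H' = H \<and> F' = coll_map E Y X F H W \<or>
      D = X - W \<and> H' = compl_coll E Y X H W \<and>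
      F' = compl_map E Y X F W (Sigma W (coll_map E Y X F H W))"
    and H: "distributed E Y Q X F H"
  shows "distributed E Y Q D F' H'"
  unfolding distributed_def
proof (intro allI impI ballI)
  fix Ws i assume Ws: "primitive_cascade E Y Q D F' H' Ws" and i: "i \<in> {1..length Ws}"
  note c = primitive_cascade_Cons[OF W D Ws]
  have D': "D = W \<or> D = X - W" using D by auto
  from i obtain j where j: "i = Suc j" "j < length Ws" by (cases i) auto
  have "set_distributed E Y (pre X (W # Ws) (Suc (Suc j)))
      (fst (along E Y X F H (W # Ws) (Suc j))) (cW X (W # Ws) (Suc (Suc j)))"
    using H c(1) j(2) unfolding distributed_def
    by (auto dest!: spec[of _ "W # Ws"] bspec[of _ _ "Suc (Suc j)"])
  then show "set_distributed E Y (pre D Ws i) (fst (along E Y D F' H' Ws (i - 1))) (cW D Ws i)"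
    unfolding along_Cons[OF c(2-4) D] pre_Cons[OF c(2-4) D'] cW_Cons[where D = D] j(1)
    by simp
qed

lemma set_distributed_if_min_gcritical:
  assumes W: "min_gcritical E Y Q X F W" and H: "distributed E Y Q X F H"
  shows "set_distributed E Y X H W"
proof -
  have "W \<subseteq> X" using W by (simp add: min_gcritical_def gcritical_def)
  then have "pre X [W] 1 = X" and "cascade X [W]"
    by (auto simp: pre_def cW_def cascade_def)
  then have "primitive_cascade E Y Q X F H [W]"
    using W by (simp add: primitive_cascade_def cW_def)
  then show ?thesis
    using H \<open>pre X [W] 1 = X\<close> unfolding distributed_def
    by (auto dest!: spec[of _ "[W]"] simp: cW_def)
qed

section \<open>Sufficiency of the generalized Hall condition\<close>

lemma hall_collection_restrict:
  assumes H: "hall_collection E X F H" and F: "\<And>u. u \<in> X \<Longrightarrow> F u \<subseteq> Y" and W: "W \<subseteq> X"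
  shows "hall_collection E W (coll_map E Y X F H W) H"
  unfolding hall_collection_def
proof
  fix V assume V: "V \<in> nonempty_subsets W"
  then have VX: "V \<in> nonempty_subsets X" using W by (auto simp: nonempty_subsets_def)
  have "H V \<subseteq> Sigma V (coll_map E Y X F H W)"
  proof (rule subrelI)
    fix a b assume ab: "(a, b) \<in> H V"
    then have a: "a \<in> V" "b \<in> F a"
      using H VX unfolding hall_collection_def by blast+
    then have "a \<in> W" "b \<in> Y" using V F W by (auto simp: nonempty_subsets_def)
    moreover have "disparate E (a, b) z" if "z \<in> compl_coll E Y X H W U" for z U
      using that ab V disparate_sym[of E "(a, b)" z]
      unfolding compl_coll_def dcompl_def by blast
    ultimately show "(a, b) \<in> Sigma V (coll_map E Y X F H W)"
      using a by (simp add: mem_coll_map_iff[OF W])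
  qed
  then show "H V \<subseteq> Sigma V (coll_map E Y X F H W) \<and> disparate_set E (H V) \<and> card V \<le> card (H V)"
    using H VX unfolding hall_collection_def by blast
qed

text \<open>
  A \<open>W\<close>-distributed Hall collection passes to the complement: of the at least
  \<open>card W + card V\<close> points in \<open>A\<close> indexed by \<open>W \<union> V\<close>, at most \<open>card W\<close> are lost.
\<close>

lemma hall_collection_complement:
  assumes H: "hall_collection E X F H" and F: "\<And>u. u \<in> X \<Longrightarrow> F u \<subseteq> Y"
    and fin: "finite X" "finite Y" and W: "W \<subseteq> X" and d: "set_distributed E Y X H W"
  shows "hall_collection E (X - W)
    (compl_map E Y X F W (Sigma W (coll_map E Y X F H W))) (compl_coll E Y X H W)"
  unfolding hall_collection_def
proof
  fix V assume V: "V \<in> nonempty_subsets (X - W)"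
  define C where "C = compl_coll E Y X H W V"
  define A where "A = H (W \<union> V)"
  define U where "U = (\<Union>U\<in>nonempty_subsets W. H U)"
  define B where "B = A \<inter> (W \<times> Y \<union> dhull E Y X U \<inter> V \<times> Y)"
  have VX: "V \<subseteq> X" "V \<inter> W = {}" using V by (auto simp: nonempty_subsets_def)
  have "W \<union> V \<in> nonempty_subsets X" using V W by (auto simp: nonempty_subsets_def)
  then have A: "A \<subseteq> Sigma (W \<union> V) F" "disparate_set E A" "card (W \<union> V) \<le> card A"
    using H unfolding hall_collection_def A_def by blast+
  then have AY: "A \<subseteq> (W \<union> V) \<times> Y" using F W VX by blast
  have CA: "C = A \<inter> dcompl E Y X U \<inter> V \<times> Y"
    unfolding C_def A_def U_def compl_coll_def ..
  have finW: "finite W" and finV: "finite V"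
    using fin(1) W VX(1) by (auto intro: finite_subset)
  have finA: "finite A" using AY finW finV fin(2) by (auto intro: finite_subset)
  have "C \<subseteq> Sigma V (compl_map E Y X F W (Sigma W (coll_map E Y X F H W)))"
  proof (rule subrelI)
    fix a b assume ab: "(a, b) \<in> C"
    then have "a \<in> V" "b \<in> F a" "b \<in> Y" using CA A(1) by auto
    moreover have "disparate E (a, b) (u, w)"
      if "u \<in> W" "w \<in> coll_map E Y X F H W u" for u w
      using that ab V disparate_sym[of E "(a, b)" "(u, w)"]
      unfolding mem_coll_map_iff[OF W] C_def by blast
    ultimately show "(a, b) \<in> Sigma V (compl_map E Y X F W (Sigma W (coll_map E Y X F H W)))"
      using VX by (auto simp: mem_compl_map_iff)
  qed
  moreover have "disparate_set E C"
    using A(2) CA unfolding disparate_set_def by (auto intro: pairwise_subset)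
  moreover have "card V \<le> card C"
  proof -
    have "A \<subseteq> B \<union> C"
      using AY VX unfolding B_def CA dhull_def dcompl_def by auto
    then have "card A \<le> card (B \<union> C)"
      using finA by (intro card_mono) (auto simp: B_def CA)
    also have "\<dots> \<le> card B + card C" by (rule card_Un_le)
    also have "card B \<le> card W"
      using d V unfolding set_distributed_def B_def A_def U_def by blast
    finally have "card A \<le> card W + card C" by simp
    moreover have "card (W \<union> V) = card W + card V"
      using finW finV VX(2) by (intro card_Un_disjoint) auto
    ultimately show ?thesis using A(3) by simp
  qed
  ultimately show "compl_coll E Y X H W V
      \<subseteq> Sigma V (compl_map E Y X F W (Sigma W (coll_map E Y X F H W))) \<and>
      disparate_set E (compl_coll E Y X H W V) \<and> card V \<le> card (compl_coll E Y X H W V)"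
    unfolding C_def by blast
qed

lemma hall_collection_graph_nonempty:
  assumes "hall_collection E X F H" and "finite X" and "X \<noteq> {}"
  shows "Sigma X F \<noteq> {}"
proof -
  have "X \<in> nonempty_subsets X" using assms(3) by (simp add: nonempty_subsets_def)
  then have "H X \<subseteq> Sigma X F" "card X \<le> card (H X)"
    using assms(1) unfolding hall_collection_def by auto
  moreover have "card X > 0" using assms(2,3) by (simp add: card_gt_0_iff)
  ultimately show ?thesis by auto
qed

lemma ghall_if_distributed:
  assumes "hall_collection E X F H" and "distributed E Y (ghall E Y) X F H"
    and "finite X" and "X \<noteq> {}"
  shows "ghall E Y X F"
proof -
  have "card X \<noteq> 0" using assms(3,4) by simp
  then consider "card X = 1" | "card X > 1" by linarith
  then show ?thesis
    using assms hall_collection_graph_nonempty[OF assms(1,3,4)]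
    unfolding ghall_iff[OF assms(3)] ghall_step_def by cases auto
qed

lemma ex_min_gcritical:
  assumes "finite X" and "gcritical E Y Q X F W"
  shows "\<exists>W'. min_gcritical E Y Q X F W'"
proof -
  have "finite W" using assms unfolding gcritical_def by (auto intro: finite_subset)
  from this assms(2) show ?thesis
  proof (induction W rule: finite_psubset_induct)
    case (psubset W)
    then show ?case unfolding min_gcritical_def by blast
  qed
qed

lemma disparate_selection_if_ghall:
  assumes "finite X" and "finite Y" and "\<And>u. u \<in> X \<Longrightarrow> F u \<subseteq> Y" and "ghall E Y X F"
  shows "\<exists>s. disparate_selection E X F s"
  using assms(1,3,4)
proof (induction "card X" arbitrary: X F rule: less_induct)
  case less
  note fin = less.prems(1) and F = less.prems(2)
  have IH: "\<exists>s. disparate_selection E D P s"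
    if "D \<subset> X" "\<And>u. u \<in> D \<Longrightarrow> P u \<subseteq> Y" "ghall E Y D P" for D P
  proof (rule less.hyps)
    show "card D < card X" using fin that(1) by (rule psubset_card_mono)
    show "finite D" using fin that(1) by (auto intro: finite_subset)
  qed (use that in auto)
  have complY: "compl_map E Y A P B Z u \<subseteq> Y" for A P B Z u
    by (auto simp: mem_compl_map_iff)
  consider "card X = 1" "Sigma X F \<noteq> {}"
    | H where "card X > 1" "hall_collection E X F H" "distributed E Y (ghall E Y) X F H"
    using less.prems(3) unfolding ghall_iff[OF fin] ghall_step_def by blast
  then show ?case
  proof cases
    case 1
    then obtain a b where "X = {a}" "b \<in> F a" by (auto simp: card_1_singleton_iff)
    then have "disparate_selection E X F (\<lambda>_. b)" by (simp add: disparate_selection_iff)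
    then show ?thesis by blast
  next
    case 2
    note H = 2(2,3)
    show ?thesis
    proof (cases "\<exists>W. gcritical E Y (ghall E Y) X F W")
      case False
      from 2 have "X \<noteq> {}" by auto
      then obtain a b where ab: "a \<in> X" "b \<in> F a"
        using hall_collection_graph_nonempty[OF H(1) fin] by auto
      have "X - {a} \<noteq> {}"
      proof
        assume "X - {a} = {}"
        then have "X \<subseteq> {a}" by auto
        then show False using 2(1) card_mono[of "{a}" X] by simp
      qed
      then have "ghall E Y (X - {a}) (compl_map E Y X F {a} {(a, b)})"
      proof -
        have "a \<in> X - (X - {a})" "b \<in> Y" using ab F by auto
        moreover have "\<not> gcritical E Y (ghall E Y) X F (X - {a})" using False by blast
        ultimately show ?thesis
          using \<open>X - {a} \<noteq> {}\<close> unfolding gcritical_def by (metis Diff_subset)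
      qed
      then obtain s where
        "disparate_selection E (X - {a}) (compl_map E Y X F {a} {(a, b)}) s"
        using IH[of "X - {a}" "compl_map E Y X F {a} {(a, b)}"] ab(1) complY by blast
      from disparate_selection_insert[of a X b F E Y s, OF ab this] show ?thesis by blast
    next
      case True
      then obtain W where W: "min_gcritical E Y (ghall E Y) X F W"
        using ex_min_gcritical[OF fin] by blast
      then have WX: "W \<subset> X" "W \<noteq> {}" by (auto simp: min_gcritical_def gcritical_def)
      \<comment> \<open>The two parts of \<open>F\<close> along \<open>W\<close>, with collections \<open>H\<close> on \<open>W\<close> and \<open>H\<^sub>W\<close> on \<open>X - W\<close>.\<close>
      define P where "P = coll_map E Y X F H W"
      define R where "R = compl_map E Y X F W (Sigma W P)"
      have d: "set_distributed E Y X H W"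
        by (rule set_distributed_if_min_gcritical[OF W H(2)])
      have "ghall E Y W P" unfolding P_def
      proof (rule ghall_if_distributed)
        show "hall_collection E W (coll_map E Y X F H W) H"
          using H(1) F WX by (intro hall_collection_restrict) auto
        show "distributed E Y (ghall E Y) W (coll_map E Y X F H W) H"
          by (rule distributed_tail[OF W _ H(2)]) simp
        show "finite W" using fin WX by (auto intro: finite_subset)
      qed (rule WX(2))
      moreover have PF: "P u \<subseteq> F u" for u
        using WX by (auto simp: P_def mem_coll_map_iff)
      ultimately obtain s where s: "disparate_selection E W P s"
        using IH[OF WX(1), of P] F WX(1) by blast
      have "ghall E Y (X - W) R" unfolding R_def P_def
      proof (rule ghall_if_distributed)
        show "hall_collection E (X - W)
            (compl_map E Y X F W (Sigma W (coll_map E Y X F H W))) (compl_coll E Y X H W)"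
          using H(1) F fin assms(2) WX d by (intro hall_collection_complement) auto
        show "distributed E Y (ghall E Y) (X - W)
            (compl_map E Y X F W (Sigma W (coll_map E Y X F H W))) (compl_coll E Y X H W)"
          by (rule distributed_tail[OF W _ H(2)]) simp
        show "finite (X - W)" using fin by simp
      qed (use WX in auto)
      then obtain t where t: "disparate_selection E (X - W) R t"
        using IH[of "X - W" R] WX complY[of X F W "Sigma W P"] unfolding R_def by blast
      have "disparate E (u, s u) (v, t v)" if "u \<in> W" "v \<in> X - W" for u v
      proof -
        have "s u \<in> P u" "t v \<in> R v" using s t that unfolding disparate_selection_iff by auto
        then have "disparate E (v, t v) (u, s u)"
          using that by (auto simp: R_def mem_compl_map_iff)
        then show ?thesis by (subst disparate_sym)
      qed
      moreover have "R u \<subseteq> F u" for u by (auto simp: R_def mem_compl_map_iff)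
      ultimately have "disparate_selection E (W \<union> (X - W)) F (\<lambda>u. if u \<in> W then s u else t u)"
        using PF by (intro disparate_selection_union[OF s t]) auto
      moreover have "W \<union> (X - W) = X" using WX by auto
      ultimately show ?thesis by auto
    qed
  qed
qed

section \<open>The calculation methods\<close>

lemma mem_elim_iff:
  "(a, b) \<in> elim E Y X F W \<longleftrightarrow>
     a \<in> X - W \<and> b \<in> F a \<and> \<not> ghall E Y W (compl_map E Y X F {a} {(a, b)})"
  by (simp add: elim_def)

lemma mem_elim_map_iff:
  "b \<in> elim_map E Y X P W a \<longleftrightarrow> a \<in> X \<and> b \<in> P a \<and> (a, b) \<notin> elim E Y X P W"
  by (auto simp: elim_map_def mapping_of_def)

text \<open>Elimination keeps every disparate selection: its points pass the test on \<open>W\<close>.\<close>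

lemma disparate_selection_elim_map:
  assumes "finite X" and P: "\<And>u. u \<in> X \<Longrightarrow> P u \<subseteq> Y"
    and s: "disparate_selection E X P s" and W: "W \<noteq> {}" "W \<subseteq> X"
  shows "disparate_selection E X (elim_map E Y X P W) s"
proof -
  have "ghall E Y W (compl_map E Y X P {a} {(a, s a)})" if a: "a \<in> X - W" for a
  proof -
    have sP: "s u \<in> P u" if "u \<in> X" for u
      using s that unfolding disparate_selection_iff by blast
    have disp: "disparate E (u, s u) (v, s v)" if "u \<in> X" "v \<in> X" "u \<noteq> v" for u v
      using s that unfolding disparate_selection_iff by blast
    have "s u \<in> compl_map E Y X P {a} {(a, s a)} u" if "u \<in> W" for u
    proof -
      have "u \<in> X" "u \<noteq> a" using that W(2) a by auto
      then show ?thesis using sP[of u] P[of u] disp[of u a] a by (auto simp: mem_compl_map_iff)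
    qed
    moreover have "disparate E (u, s u) (v, s v)" if "u \<in> W" "v \<in> W" "u \<noteq> v" for u v
      using disp[of u v] that W(2) by auto
    ultimately have "disparate_selection E W (compl_map E Y X P {a} {(a, s a)}) s"
      by (simp add: disparate_selection_iff)
    then show ?thesis
    proof (rule ghall_if_disparate_selection[rotated 3])
      show "finite W" using W(2) assms(1) by (rule finite_subset)
    qed (use W(1) in \<open>auto simp: mem_compl_map_iff\<close>)
  qed
  then have "(a, s a) \<notin> elim E Y X P W" for a
    unfolding mem_elim_iff by blast
  then show ?thesis using s unfolding disparate_selection_iff mem_elim_map_iff by blast
qed

lemma method1_correct:
  assumes "method1 E Y X P K st" and "finite X"
    and "\<And>u. u \<in> X \<Longrightarrow> P u \<subseteq> Y"
  shows "(\<forall>s. disparate_selection E X P s \<longrightarrow> disparate_selection E X K s) \<and>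
    (\<forall>u\<in>X. K u \<subseteq> P u) \<and>
    (st = Step3 \<longrightarrow> (\<forall>W. \<not> elimination_set E Y X K W)) \<and>
    (st = Step5 \<longrightarrow> (\<exists>u\<in>X. K u = {}))"
  using assms
proof (induction rule: method1.induct)
  case (stop3 P)
  then show ?case by simp
next
  case (stop5 P W)
  have "disparate_selection E X (elim_map E Y X P W) s" if "disparate_selection E X P s" for s
  proof (rule disparate_selection_elim_map[OF stop5.prems that])
    show "W \<noteq> {}" "W \<subseteq> X" using stop5.hyps(1) by (simp_all add: elimination_set_def)
  qed
  moreover have "elim_map E Y X P W u \<subseteq> P u" for u by (auto simp: mem_elim_map_iff)
  ultimately show ?case using stop5.hyps(2) by simp
next
  case (continue P W K st)
  have sub: "elim_map E Y X P W u \<subseteq> P u" for u by (auto simp: mem_elim_map_iff)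
  have "disparate_selection E X (elim_map E Y X P W) s" if "disparate_selection E X P s" for s
  proof (rule disparate_selection_elim_map[OF continue.prems that])
    show "W \<noteq> {}" "W \<subseteq> X" using continue.hyps(1) by (simp_all add: elimination_set_def)
  qed
  moreover have "elim_map E Y X P W u \<subseteq> Y" if "u \<in> X" for u
    using sub continue.prems(2)[OF that] by (rule subset_trans)
  note IH = continue.IH[OF continue.prems(1) this]
  moreover have "K u \<subseteq> P u" if "u \<in> X" for u
    using IH that sub[of u] by blast
  ultimately show ?case by simp
qed

text \<open>
  If there is no elimination set, then the test on \<open>X - {a}\<close> shows that after choosing any point
  \<open>(a, b)\<close> of the graph, what remains still has a disparate selection.
\<close>

lemma disparate_selection_if_no_elimination_set:
  assumes "finite X" and "finite Y"
    and no: "\<And>W. \<not> elimination_set E Y X K W"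
    and ab: "a \<in> X" "b \<in> K a" and "X - {a} \<noteq> {}"
  shows "\<exists>s. disparate_selection E (X - {a}) (compl_map E Y X K {a} {(a, b)}) s"
proof -
  have "(a, b) \<notin> elim E Y X K (X - {a})"
    using no[of "X - {a}"] assms(6) unfolding elimination_set_def by blast
  then have "ghall E Y (X - {a}) (compl_map E Y X K {a} {(a, b)})"
    using ab unfolding mem_elim_iff by blast
  then show ?thesis
    using assms(1,2) by (intro disparate_selection_if_ghall) (auto simp: mem_compl_map_iff)
qed

text \<open>
  At index \<open>i\<close> the domain has \<open>n - i + 1\<close> vertices. A stop at Step 3 excludes a disparate
  selection because elimination would have kept it; at a later index such a stop cannot
  occur, because the mapping there still has a disparate selection.
\<close>

lemma method2_correct:
  assumes "method2 E Y n x y i D P m st" and "finite D" and "finite Y"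
    and "\<And>u. u \<in> D \<Longrightarrow> P u \<subseteq> Y" and "card D + i = Suc n"
  shows "(st = Step3 \<longrightarrow> \<not> (\<exists>s. disparate_selection E D P s)) \<and>
    (st = Step5 \<longrightarrow> m = n \<and> (\<exists>s. disparate_selection E D P s \<and> x ` {i..n} = D \<and>
       (\<forall>j\<in>{i..n}. s (x j) = y j)))"
  using assms
proof (induction rule: method2.induct)
  case (stop3 D P K i)
  note m1 = method1_correct[OF stop3(1,2,4)]
  then obtain u where "u \<in> D" "K u = {}" by blast
  then have "\<not> disparate_selection E D K s" for s
    unfolding disparate_selection_iff by blast
  with m1 show ?case by blast
next
  case (stop5 D P K i)
  then have "card D = 1" by simp
  then have D: "D = {x i}" using stop5.hyps(2) by (auto simp: card_1_singleton_iff)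
  moreover have "y i \<in> P (x i)"
    using method1_correct[OF stop5.hyps(1) stop5.prems(1,3)] stop5.hyps(2) by blast
  ultimately have "disparate_selection E D P (\<lambda>_. y i)"
    by (simp add: disparate_selection_iff)
  then have "\<exists>s. disparate_selection E D P s \<and> x ` {i..n} = D \<and> (\<forall>j\<in>{i..n}. s (x j) = y j)"
    using D stop5.hyps(3) by (intro exI[of _ "\<lambda>_. y i"]) simp
  then show ?case using stop5.hyps(3) by simp
next
  case (continue D P K i m st)
  have m1: "\<not> elimination_set E Y D K W" "u \<in> D \<Longrightarrow> K u \<subseteq> P u" for W u
    using method1_correct[OF continue.hyps(1) continue.prems(1,3)] by auto
  define R where "R = compl_map E Y D K {x i} {(x i, y i)}"
  have xi: "x i \<in> D" "y i \<in> K (x i)" using continue.hyps(2) by auto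
  have card: "card (D - {x i}) + Suc i = Suc n"
    using continue.prems(4) card_Suc_Diff1[OF continue.prems(1) xi(1)] by simp
  then have "card (D - {x i}) \<noteq> 0" and "i < n"
    using continue.hyps(3) by auto
  then have ne: "D - {x i} \<noteq> {}" by (metis card.empty)
  have IH: "(st = Step3 \<longrightarrow> \<not> (\<exists>s. disparate_selection E (D - {x i}) R s)) \<and>
    (st = Step5 \<longrightarrow> m = n \<and> (\<exists>s. disparate_selection E (D - {x i}) R s \<and>
       x ` {Suc i..n} = D - {x i} \<and> (\<forall>j\<in>{Suc i..n}. s (x j) = y j)))"
    unfolding R_def using continue.prems card
    by (intro continue.IH) (auto simp: mem_compl_map_iff)
  have "st \<noteq> Step3"
  proof
    assume "st = Step3"
    from disparate_selection_if_no_elimination_set[OF continue.prems(1,2) m1(1) xi ne]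
    show False using IH \<open>st = Step3\<close> unfolding R_def by blast
  qed
  moreover have "m = n \<and> (\<exists>s. disparate_selection E D P s \<and> x ` {i..n} = D \<and>
       (\<forall>j\<in>{i..n}. s (x j) = y j))" if "st = Step5"
  proof -
    from IH that obtain s where "m = n" and s: "disparate_selection E (D - {x i}) R s"
      and img: "x ` {Suc i..n} = D - {x i}" and sx: "\<forall>j\<in>{Suc i..n}. s (x j) = y j" by auto
    have "disparate_selection E D K (s(x i := y i))"
      using xi s unfolding R_def by (rule disparate_selection_insert)
    then have "disparate_selection E D P (s(x i := y i))"
      using m1 unfolding disparate_selection_iff by blast
    moreover have split: "{i..n} = insert i {Suc i..n}" using \<open>i < n\<close> by auto
    then have "x ` {i..n} = D" using img xi(1) by auto
    moreover have "\<forall>j\<in>{i..n}. (s(x i := y i)) (x j) = y j"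
    proof
      fix j assume "j \<in> {i..n}"
      then consider "j = i" | "j \<in> {Suc i..n}" unfolding split by blast
      then show "(s(x i := y i)) (x j) = y j"
      proof cases
        case 2
        then have "x j \<noteq> x i" using img by blast
        then show ?thesis using sx 2 by simp
      qed simp
    qed
    ultimately show ?thesis using \<open>m = n\<close> by blast
  qed
  ultimately show ?case by blast
qed

theorem theorem11p3:
  fixes X :: "'x set" and E :: "'x set set" and Y :: "'y set" and F :: "'x \<Rightarrow> 'y set"
    and x :: "nat \<Rightarrow> 'x" and y :: "nat \<Rightarrow> 'y" and imax :: nat and st :: stop_step
  assumes "simple_graph X E" and "finite X" and "finite Y" and "\<And>u. u \<in> X \<Longrightarrow> F u \<subseteq> Y"
    and "method2 E Y (card X) x y 1 X F imax st"
  shows "((\<exists>s. disparate_selection E X F s) \<longleftrightarrow> st \<noteq> Step3) \<and>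
         (st \<noteq> Step3 \<longleftrightarrow> st = Step5) \<and>
         (st = Step5 \<longleftrightarrow>
            imax = card X \<and>
            (\<exists>s. disparate_selection E X F s \<and> x ` {1..imax} = X \<and>
                 (\<forall>i\<in>{1..imax}. s (x i) = y i)))"
proof -
  note c = method2_correct[OF assms(5,2,3,4)]
  have c3: "st = Step3 \<longrightarrow> \<not> (\<exists>s. disparate_selection E X F s)"
    and c5: "st = Step5 \<longrightarrow> imax = card X \<and> (\<exists>s. disparate_selection E X F s \<and>
      x ` {1..card X} = X \<and> (\<forall>j\<in>{1..card X}. s (x j) = y j))"
    using c by auto
  have "st = Step3 \<longleftrightarrow> st \<noteq> Step5" by (cases st) auto
  with c3 c5 show ?thesis by blast
qed

end
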